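(* Let $\Omega\subset\mathbb{R}^2$ be a bounded domain of genus $g$ such that the components of $\partial\Omega$ are simple closed curves $\gamma_0,\dots,\gamma_g$. Let $f:\overline{\Omega}\to\mathbb{R}$ be continuous. Then $s\leq 2(n+g-1)$, where $n$ is the number of nodal domains of $f$ in $\Omega$ and $s$ is the number of sign changes of $f$ along $\partial\Omega$.
   Context: A domain is an open connected set. Genus $g$ here means that $\partial\Omega$ has $g+1$ connected components (i.e. $\Omega$ has $g$ holes). The nodal domains of $f$ in $\Omega$ are the connected components of $\Omega\setminus\overline{\{z\in\Omega: f(z)=0\}}$. For a simple closed curve $\gamma$, the number of sign changes of $f$ on $\gamma$ is the largest integer $m$ such that there exist $m$ points $p_1,\dots,p_m$ on $\gamma$, listed in cyclic order, with $f(p_k)\neq0$ for all $k$ and $f(p_k)$, $f(p_{k+1})$ of opposite signs for all $k$ (indices mod $m$), or $0$ if no such points with $m\ge2$ exist; the number $s$ of sign changes of $f$ along $\partial\Omega$ is the sum over $i=0,\dots,g$ of the numbers of sign changes of $f$ on $\gamma_i$.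
   Formalization: The bound is read as 0 when n = g = 0 (f identically zero, one boundary curve), where s = 0 and the stated bound −2 would be false; the number n of nodal domains is assumed finite, the bound being vacuous otherwise. *)

theory Defs
  imports "HOL-Analysis.Analysis" "HOL-Library.Extended_Nat"
begin

definition nodal_domains :: "(complex \<Rightarrow> real) \<Rightarrow> complex set \<Rightarrow> complex set set" where
  "nodal_domains f \<Omega> = components (\<Omega> - closure {z \<in> \<Omega>. f z = 0})"

text \<open>Number of sign changes of f along the closed curve parametrised by p on [0,1]:
  the supremum (in enat) of all m >= 2 such that there are parameters
  t 0 < t 1 < ... < t (m-1) in [0,1) (i.e. points listed in cyclic order along the curve)
  with f nonzero there and consecutive values (cyclically) of opposite sign; 0 if none.\<close>
definition sign_changes :: "(complex \<Rightarrow> real) \<Rightarrow> (real \<Rightarrow> complex) \<Rightarrow> enat" where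
  "sign_changes f p = Sup (enat ` {m. m \<ge> 2 \<and>
      (\<exists>t::nat \<Rightarrow> real. strict_mono_on {..<m} t \<and> (\<forall>k<m. t k \<in> {0..<1}) \<and>
         (\<forall>k<m. f (p (t k)) \<noteq> 0) \<and>
         (\<forall>k<m. f (p (t k)) * f (p (t (Suc k mod m))) < 0))})"

end

theory Submission
  imports Defs
begin

text \<open>
  Since accessible points are dense in the boundary, the points where \<open>f\<close> is positive in an alternating
  choice of boundary points can be moved to points accessible from positive nodal domains. Joining
  these \<open>s/2\<close> points inside their nodal domains by arcs yields a forest \<open>T\<close>. Starting from the
  \<open>g + 1\<close> boundary curves, each arc either reduces the number of components or cuts a face of \<open>\<Omega> - T\<close>
  in two, so there are at least \<open>1 + (s/2 - n\<^sub>+) - g\<close> faces, where \<open>n\<^sub>+\<close> is the number of positive nodal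
  domains. Every face touches a boundary curve between two consecutive positive points, and hence
  contains a neighbourhood in \<open>\<Omega>\<close> of a boundary point where \<open>f\<close> is negative, and with it a negative
  nodal domain. Thus \<open>1 + s/2 - n\<^sub>+ - g \<le> n\<^sub>-\<close>.
\<close>

section \<open>Accessible points and partitions into open sets\<close>

text \<open>For \<open>p\<close> on the frontier of \<open>A\<close> this is the classical notion of
  an accessible boundary point. A path suffices here, since an arc can be extracted from it
  later.\<close>

definition accessible :: "complex set \<Rightarrow> complex \<Rightarrow> bool" where
  "accessible A p \<longleftrightarrow> (\<exists>h. path h \<and> h ` {0..<1} \<subseteq> A \<and> pathfinish h = p)"

text \<open>The members need not be connected: only a lower bound for the number of faces is wanted,
  so a partition into nonempty open sets stands in for the set of components.\<close>

definition open_partition :: "complex set set \<Rightarrow> complex set \<Rightarrow> bool" where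
  "open_partition \<W> U \<longleftrightarrow>
     finite \<W> \<and> pairwise disjnt \<W> \<and> \<Union>\<W> = U \<and> (\<forall>W\<in>\<W>. open W \<and> W \<noteq> {})"

lemma accessible_path_component:
  assumes "accessible A p"
  obtains a where "a \<in> A" "path_component (insert p A) p a"
proof -
  obtain h where h: "path h" "h ` {0..<1} \<subseteq> A" "pathfinish h = p"
    using assms by (auto simp: accessible_def)
  have "{0..1::real} = insert 1 {0..<1}" by auto
  then have "path_image h \<subseteq> insert p A"
    using h by (auto simp: path_image_def pathfinish_def)
  then have "path_component (insert p A) (h 0) p"
    using h by (auto simp: path_component_def pathstart_def)
  moreover have "h 0 \<in> A" using h by auto
  ultimately show ?thesis using that path_component_sym by blast
qed

text \<open>Both access paths start in the path-connected set \<open>A\<close>, so they can be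
  linked inside it; the resulting path contains an arc.\<close>

lemma arc_between_accessible_points:
  assumes A: "open A" "connected A" and p: "accessible A p" and q: "accessible A q" and "p \<noteq> q"
  obtains c where "arc c" "pathstart c = p" "pathfinish c = q" "path_image c \<subseteq> insert p (insert q A)"
proof -
  let ?B = "insert p (insert q A)"
  obtain a where a: "a \<in> A" "path_component (insert p A) p a"
    using accessible_path_component [OF p] by blast
  obtain b where b: "b \<in> A" "path_component (insert q A) q b"
    using accessible_path_component [OF q] by blast
  have "path_component A a b"
    using A a b by (metis connected_open_path_connected path_connected_component)
  then have "path_component ?B p q"
    using a(2) b(2)
    by (meson path_component_of_subset path_component_sym path_component_trans subset_insertI
        insert_mono subset_insertI2 order_refl)
  then obtain g where g: "path g" "path_image g \<subseteq> ?B" "pathstart g = p" "pathfinish g = q"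
    by (auto simp: path_component_def)
  obtain c where "arc c" "path_image c \<subseteq> path_image g" "pathstart c = p" "pathfinish c = q"
    using path_contains_arc [OF g(1,3,4) \<open>p \<noteq> q\<close>] by blast
  with g that show ?thesis by blast
qed

text \<open>Cuts the arc at the first parameter where it meets the closed set \<open>T\<close>. In
  the forest this makes each new branch meet the old branches in a single point.\<close>

lemma arc_first_hit:
  fixes g :: "real \<Rightarrow> complex"
  assumes "arc g" "closed T" "pathstart g \<notin> T" "pathfinish g \<in> T"
  obtains c where "arc c" "pathstart c = pathstart g" "path_image c \<subseteq> path_image g"
    "path_image c \<inter> T = {pathfinish c}"
proof -
  obtain u where u: "0 \<le> u" "u \<le> 1" "g u \<in> frontier (- T)"
      "path_image (subpath 0 u g) - {g u} \<subseteq> interior (- T)"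
    using subpath_to_frontier [of g "- T"] assms arc_imp_path
    by (metis ComplD ComplI closure_subset subsetD)
  have gu: "g u \<in> T"
    using u(3) \<open>closed T\<close> by (metis frontier_complement frontier_subset_eq subsetD)
  have "u \<noteq> 0"
    using gu assms(3) by (auto simp: pathstart_def)
  then have "arc (subpath 0 u g)"
    using assms(1) u by (simp add: arc_subpath_arc)
  moreover have fin: "pathfinish (subpath 0 u g) = g u"
    by (simp add: pathfinish_def subpath_def)
  have "g u \<in> path_image (subpath 0 u g)"
    using pathfinish_in_path_image [of "subpath 0 u g"] fin by simp
  then have "path_image (subpath 0 u g) \<inter> T = {pathfinish (subpath 0 u g)}"
    using u(4) gu interior_subset [of "- T"] fin by auto
  moreover have "path_image (subpath 0 u g) \<subseteq> path_image g"
    using u by (simp add: path_image_subpath_subset)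
  ultimately show ?thesis
    using that [of "subpath 0 u g"] by (simp add: pathstart_def subpath_def)
qed

section \<open>Open partitions cut by arcs\<close>

lemma open_not_subset_arc:
  fixes c :: "real \<Rightarrow> complex"
  assumes "arc c" "open W" "W \<noteq> {}"
  shows "W - path_image c \<noteq> {}"
proof
  assume "W - path_image c = {}"
  then have W: "W \<subseteq> c ` {0..1}" by (auto simp: path_image_def)
  have "continuous_on {0..1} c" "inj_on c {0..1}"
    using assms(1) by (auto simp: arc_def path_def)
  then have inv: "continuous_on (c ` {0..1}) (inv_into {0..1} c)"
    by (intro continuous_on_inv) auto
  \<comment> \<open>On the compact arc the inverse of \<open>c\<close> is a continuous injection
    into the real line; restricted to the open plane set \<open>W\<close> it would contradict
    invariance of dimension.\<close>
  have "DIM(complex) \<le> DIM(real)"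
  proof (rule invariance_of_dimension)
    show "continuous_on W (inv_into {0..1} c)"
      using inv W continuous_on_subset by blast
    show "inj_on (inv_into {0..1} c) W"
      using W by (rule inj_on_inv_into)
  qed (use assms in auto)
  then show False by simp
qed

text \<open>An arc contains no nonempty open set, so removing it empties no member and the number of
  members cannot drop.\<close>

lemma open_partition_minus_arc:
  assumes "open_partition \<W> U" "arc c"
  shows "open_partition ((\<lambda>W. W - path_image c) ` \<W>) (U - path_image c)"
    and "card ((\<lambda>W. W - path_image c) ` \<W>) = card \<W>"
proof -
  have W: "finite \<W>" "pairwise disjnt \<W>" "\<Union>\<W> = U" "\<And>W. W \<in> \<W> \<Longrightarrow> open W \<and> W \<noteq> {}"
    using assms by (auto simp: open_partition_def)
  have ne: "W - path_image c \<noteq> {}" if "W \<in> \<W>" for W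
    using W(4) [OF that] open_not_subset_arc [OF assms(2)] by blast
  have op: "open (W - path_image c)" if "W \<in> \<W>" for W
    using W(4) [OF that] assms(2) by (simp add: closed_arc_image open_Diff)
  have "inj_on (\<lambda>W. W - path_image c) \<W>"
  proof (rule inj_onI)
    fix V W assume VW: "V \<in> \<W>" "W \<in> \<W>" "V - path_image c = W - path_image c"
    then have "\<not> disjnt V W"
      using ne [of V] by (auto simp: disjnt_def)
    then show "V = W"
      using W(2) VW by (auto simp: pairwise_def)
  qed
  then show "card ((\<lambda>W. W - path_image c) ` \<W>) = card \<W>"
    by (rule card_image)
  have "pairwise disjnt ((\<lambda>W. W - path_image c) ` \<W>)"
    using W(2) by (fastforce simp: pairwise_def disjnt_def)
  then show "open_partition ((\<lambda>W. W - path_image c) ` \<W>) (U - path_image c)"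
    using W ne op by (auto simp: open_partition_def)
qed

lemma open_partition_split:
  assumes "open_partition \<W> U" "W \<in> \<W>" "open V1" "open V2" "V1 \<noteq> {}" "V2 \<noteq> {}"
    "V1 \<inter> V2 = {}" "V1 \<union> V2 = W"
  shows "open_partition (insert V1 (insert V2 (\<W> - {W}))) U"
    and "card (insert V1 (insert V2 (\<W> - {W}))) = Suc (card \<W>)"
proof -
  have W: "finite \<W>" "pairwise disjnt \<W>" "\<Union>\<W> = U" "\<And>W. W \<in> \<W> \<Longrightarrow> open W \<and> W \<noteq> {}"
    using assms by (auto simp: open_partition_def)
  have d: "disjnt V W" if "V \<in> \<W> - {W}" for V
    using W(2) that assms(2) by (auto simp: pairwise_def)
  have d1: "disjnt V V1" "disjnt V V2" "disjnt V1 V" "disjnt V2 V" if "V \<in> \<W> - {W}" for V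
    using d [OF that] assms(8) by (auto simp: disjnt_def)
  have "pairwise disjnt (\<W> - {W})"
    using W(2) by (rule pairwise_subset) auto
  moreover have "disjnt V1 V2" using assms(7) by (simp add: disjnt_def)
  ultimately have "pairwise disjnt (insert V1 (insert V2 (\<W> - {W})))"
    using d1 by (auto simp: pairwise_insert dest: disjnt_sym)
  moreover have "\<Union> (insert V1 (insert V2 (\<W> - {W}))) = U"
    using assms(2,8) W(3) by auto
  ultimately show "open_partition (insert V1 (insert V2 (\<W> - {W}))) U"
    using W assms by (auto simp: open_partition_def)
  have "V1 \<notin> \<W> - {W}" "V2 \<notin> \<W> - {W}" "V1 \<noteq> V2"
    using d1 [of V1] d1 [of V2] assms(5-7) by (auto simp: disjnt_def)
  then show "card (insert V1 (insert V2 (\<W> - {W}))) = Suc (card \<W>)"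
    using W(1) assms(2) card_Suc_Diff1 [OF W(1) assms(2)] by simp
qed

text \<open>The ends of \<open>c\<close> can be joined by an arc inside \<open>X\<close>, which
  completes \<open>c\<close> to a Jordan curve. The member of the partition around an interior point
  of \<open>c\<close> meets this curve only along \<open>c\<close> and is split by its two
  sides.\<close>

lemma open_partition_cut_by_crosscut:
  fixes X :: "complex set"
  assumes part: "open_partition \<W> U" and c: "arc c" "path_image c \<inter> X = {pathstart c, pathfinish c}"
    and sub: "path_image c \<subseteq> U \<union> X" and "U \<inter> X = {}"
    and conn: "path_component X (pathstart c) (pathfinish c)"
  obtains \<W>' where "open_partition \<W>' (U - path_image c)" "card \<W>' = Suc (card \<W>)"
proof -
  obtain d0 where "path d0" "path_image d0 \<subseteq> X"
    "pathstart d0 = pathfinish c" "pathfinish d0 = pathstart c"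
    using path_component_sym [OF conn] unfolding path_component_def by blast
  then obtain d where d: "arc d" "path_image d \<subseteq> X"
    "pathstart d = pathfinish c" "pathfinish d = pathstart c"
    by (metis arc_distinct_ends c(1) order_trans path_contains_arc)
  define J where "J = path_image (c +++ d)"
  have J: "J = path_image c \<union> path_image d"
    unfolding J_def using d by (simp add: path_image_join)
  have sp: "simple_path (c +++ d)" "pathfinish (c +++ d) = pathstart (c +++ d)"
    using c d by (auto intro!: simple_path_join_loop)
  note jor = Jordan_inside_outside [OF sp, folded J_def]
  \<comment> \<open>Any point of \<open>c\<close> other than its ends would do: it is not in
    \<open>X\<close>, so it lies in a member of the partition, and this is the member to be
    split.\<close>
  have "c (1/2) \<noteq> pathstart c" "c (1/2) \<noteq> pathfinish c"
    using c(1) inj_onD [of c "{0..1}" "1/2" 0] inj_onD [of c "{0..1}" "1/2" 1]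
    by (auto simp: arc_def pathstart_def pathfinish_def)
  moreover have cx: "c (1/2) \<in> path_image c" by (auto simp: path_image_def)
  ultimately have "c (1/2) \<in> U" using sub c(2) by blast
  then obtain W where W: "W \<in> \<W>" "c (1/2) \<in> W"
    using part by (auto simp: open_partition_def)
  then have "open W" "W \<subseteq> U"
    using part by (auto simp: open_partition_def)
  define W' where "W' = W - path_image c"
  \<comment> \<open>Each point of a Jordan curve lies on the frontier of both its sides, so the open
    set \<open>W\<close> around \<open>c (1/2)\<close> meets both.\<close>
  have clos: "c (1/2) \<in> closure (inside J)" "c (1/2) \<in> closure (outside J)"
    using jor cx J by (auto simp: frontier_def)
  have WJ: "W \<inter> J \<subseteq> path_image c"
    using J d(2) \<open>W \<subseteq> U\<close> \<open>U \<inter> X = {}\<close> by blast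
  have "W \<inter> inside J \<noteq> {}" "W \<inter> outside J \<noteq> {}"
    using clos W(2) open_Int_closure_eq_empty [OF \<open>open W\<close>] by blast+
  then have ne: "W' \<inter> inside J \<noteq> {}" "W' \<inter> outside J \<noteq> {}"
    using inside_no_overlap [of J] outside_no_overlap [of J] J unfolding W'_def by blast+
  have op: "open W'"
    unfolding W'_def using \<open>open W\<close> c(1) by (simp add: closed_arc_image open_Diff)
  have "(W' \<inter> inside J) \<union> (W' \<inter> outside J) = W'"
    using jor WJ unfolding W'_def by blast
  moreover have "W' \<in> (\<lambda>W. W - path_image c) ` \<W>"
    using W(1) W'_def by blast
  moreover have "open (W' \<inter> inside J)" "open (W' \<inter> outside J)"
    using op jor by auto
  moreover have "(W' \<inter> inside J) \<inter> (W' \<inter> outside J) = {}"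
    using jor by blast
  ultimately show ?thesis
    using that [OF open_partition_split(1) [OF open_partition_minus_arc(1) [OF part c(1)]]]
      open_partition_split(2) [OF open_partition_minus_arc(1) [OF part c(1)]] ne
      open_partition_minus_arc(2) [OF part c(1)]
    by simp
qed

section \<open>Forests of arcs attached to the boundary\<close>

text \<open>
  The points of \<open>P\<close> are attached one at a time to the forest \<open>T\<close>. An arc that closes up within a
  path component of \<open>\<Gamma> \<union> T\<close> completes a Jordan curve and so splits a member of \<open>\<W>\<close>; otherwise it
  merges two path components, and a representative can be dropped from \<open>M\<close>. Since only arcs and
  isolated points are attached, each meeting \<open>T\<close> in at most one point, \<open>T\<close> never separates the plane.
\<close>

lemma accessible_forest:
  fixes \<Gamma> \<Omega> :: "complex set" and D :: "complex \<Rightarrow> complex set"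
  assumes "closed \<Gamma>" "open \<Omega>" "\<Omega> \<noteq> {}" "\<Omega> \<inter> \<Gamma> = {}"
    and M0: "finite M0" "\<And>x. x \<in> \<Gamma> \<Longrightarrow> \<exists>m\<in>M0. path_component \<Gamma> m x"
    and "finite P" "P \<subseteq> \<Gamma>"
    and D: "\<forall>p\<in>P. open (D p) \<and> connected (D p) \<and> D p \<subseteq> \<Omega> \<and> accessible (D p) p"
    and disj: "\<forall>p\<in>P. \<forall>q\<in>P. D p = D q \<or> D p \<inter> D q = {}"
  shows "\<exists>T M \<W>. compact T \<and> connected (- T) \<and> T \<inter> \<Gamma> = P \<and> T \<subseteq> P \<union> \<Union>(D ` P) \<and>
    finite M \<and> (\<forall>x\<in>\<Gamma> \<union> T. \<exists>m\<in>M. path_component (\<Gamma> \<union> T) m x) \<and>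
    open_partition \<W> (\<Omega> - T) \<and> 1 + card P + card M \<le> card \<W> + card (D ` P) + card M0"
  using \<open>finite P\<close> \<open>P \<subseteq> \<Gamma>\<close> D disj
proof (induction P rule: finite_induct)
  case empty
  \<comment> \<open>The empty forest has the single face \<open>\<Omega>\<close> and keeps all of
    \<open>M0\<close>: the counting inequality starts as an equality.\<close>
  have "open_partition {\<Omega>} (\<Omega> - {})"
    using assms by (auto simp: open_partition_def)
  moreover have "connected (- {} :: complex set)" by (simp add: convex_connected)
  ultimately show ?case
    using M0 by (intro exI [of _ "{}"] exI [of _ M0] exI [of _ "{\<Omega>}"]) auto
next
  case (insert p F)
  have F: "F \<subseteq> \<Gamma>" using insert.prems(1) by simp
  have DomF: "\<forall>q\<in>F. open (D q) \<and> connected (D q) \<and> D q \<subseteq> \<Omega> \<and> accessible (D q) q"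
    using insert.prems(2) by blast
  have disjF: "\<forall>q\<in>F. \<forall>r\<in>F. D q = D r \<or> D q \<inter> D r = {}"
    using insert.prems(3) by blast
  obtain T M \<W>
    where T: "compact T" "connected (- T)" "T \<inter> \<Gamma> = F" "T \<subseteq> F \<union> \<Union>(D ` F)"
      and M: "finite M" "\<forall>x\<in>\<Gamma> \<union> T. \<exists>m\<in>M. path_component (\<Gamma> \<union> T) m x"
      and \<W>: "open_partition \<W> (\<Omega> - T)"
      and card: "1 + card F + card M \<le> card \<W> + card (D ` F) + card M0"
    using insert.IH [OF F DomF disjF] by (elim exE conjE) (rule that)
  have p: "p \<in> \<Gamma>" "p \<notin> T" "open (D p)" "connected (D p)" "D p \<subseteq> \<Omega>" "accessible (D p) p"
    using insert T(3) by auto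
  show ?case
  proof (cases "D p \<in> D ` F")
    \<comment> \<open>The set \<open>D p\<close> is new, so \<open>p\<close> joins the forest as an
      isolated vertex. The faces do not change, and the number of points and the number of sets used
      both grow by one.\<close>
    case False
    have "connected (- (T \<union> {p}))"
    proof (rule Janiszewski_connected)
      show "connected (T \<inter> {p})" using p by simp
      show "connected (- {p})"
        by (simp add: connected_punctured_universe)
    qed (use T in auto)
    moreover have "\<Gamma> \<union> insert p T = \<Gamma> \<union> T" "\<Omega> - insert p T = \<Omega> - T"
      using p assms(4) by auto
    moreover have "compact (insert p T)" using T(1) by (rule compact_insert)
    moreover have "insert p T \<inter> \<Gamma> = insert p F" using T(3) p(1) by auto
    moreover have "insert p T \<subseteq> insert p F \<union> \<Union> (D ` insert p F)" using T(4) by auto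
    moreover have "card (D ` insert p F) = Suc (card (D ` F))" "card (insert p F) = Suc (card F)"
      using False insert.hyps by auto
    ultimately show ?thesis
      using M \<W> card
      by (intro exI [of _ "insert p T"] exI [of _ M] exI [of _ \<W>]) auto
  next
    case True
    then obtain q where q: "q \<in> F" "D q = D p" by auto
    have "p \<noteq> q" "q \<in> T" using q(1) insert.hyps(2) T(3) by auto
    have "accessible (D p) q" using DomF q by metis
    then obtain c0 where c0: "arc c0" "pathstart c0 = p" "pathfinish c0 = q"
        "path_image c0 \<subseteq> insert p (insert q (D p))"
      using arc_between_accessible_points [OF p(3,4,6) _ \<open>p \<noteq> q\<close>] by blast
    \<comment> \<open>The connection from \<open>p\<close> to \<open>q\<close> stops at its first
      point of \<open>T\<close>, which may be \<open>q\<close> or a point of an earlier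
      branch.\<close>
    obtain c where c: "arc c" "pathstart c = p" "path_image c \<subseteq> insert p (insert q (D p))"
        "path_image c \<inter> T = {pathfinish c}"
    proof (rule arc_first_hit [OF c0(1) compact_imp_closed [OF T(1)]])
      show "pathstart c0 \<notin> T" "pathfinish c0 \<in> T" using c0 p(2) \<open>q \<in> T\<close> by auto
    qed (use c0 in auto)
    define b where "b = pathfinish c"
    let ?X = "\<Gamma> \<union> T" and ?T' = "T \<union> path_image c" and ?X' = "\<Gamma> \<union> (T \<union> path_image c)"
    have pc: "p \<in> path_image c" "b \<in> path_image c" and "b \<in> T"
      using c b_def pathstart_in_path_image [of c] pathfinish_in_path_image [of c] by auto
    have c\<Gamma>: "path_image c \<inter> \<Gamma> \<subseteq> {p, q}"
      using c(3) p(5) assms(4) by auto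
    then have cX: "path_image c \<inter> ?X = {pathstart c, pathfinish c}"
    proof -
      have "x = p \<or> x = b" if "x \<in> path_image c" "x \<in> ?X" for x
        using that c\<Gamma> c(4) \<open>q \<in> T\<close> unfolding b_def by auto
      then show ?thesis using pc p(1) \<open>b \<in> T\<close> c(2) unfolding b_def by auto
    qed
    have "connected (- ?T')"
    proof (rule Janiszewski_connected)
      show "connected (T \<inter> path_image c)"
        using c(4) by (simp add: Int_commute)
    qed (use T c(1) in \<open>auto simp: closed_arc_image connected_arc_complement\<close>)
    moreover have "compact ?T'"
      using T(1) c(1) by (simp add: compact_Un compact_arc_image)
    moreover have "?T' \<inter> \<Gamma> = insert p F"
      using T(3) c\<Gamma> p(1) pc q(1) by auto
    moreover have "?T' \<subseteq> insert p F \<union> \<Union> (D ` insert p F)"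
      using T(4) c(3) q by auto
    moreover have DF: "D ` insert p F = D ` F" "card (insert p F) = Suc (card F)"
      using True insert.hyps by auto
    \<comment> \<open>There is one more point but no new set \<open>D p\<close>, so the inequality
      has to be paid for by one more face or one representative fewer.\<close>
    moreover have "\<exists>M' \<W>'. finite M' \<and> (\<forall>x\<in>?X'. \<exists>m\<in>M'. path_component ?X' m x) \<and>
        open_partition \<W>' (\<Omega> - ?T') \<and> card M' + Suc (card \<W>) \<le> card M + card \<W>'"
    proof -
      have mono: "path_component ?X' x y" if "path_component ?X x y" for x y
        by (rule path_component_of_subset [OF _ that]) auto
      have bc: "path_component ?X' b x" if "x \<in> path_image c" for x
      proof -
        have "path_component (path_image c) b x"
          using path_connected_path_image [OF arc_imp_path [OF c(1)]] that pc(2)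
          by (auto simp: path_connected_component)
        then show ?thesis by (rule path_component_of_subset [rotated]) auto
      qed
      have span: "\<exists>m\<in>M. path_component ?X' m x" if "x \<in> ?X'" for x
      proof (cases "x \<in> ?X")
        case True
        then show ?thesis using M(2) mono by blast
      next
        case False
        then have "path_component ?X' b x" using that bc by blast
        moreover obtain m where "m \<in> M" "path_component ?X' m b"
          using M(2) mono \<open>b \<in> T\<close> by blast
        ultimately show ?thesis using path_component_trans by blast
      qed
      obtain m1 where m1: "m1 \<in> M" "path_component ?X m1 p" using M(2) p(1) by blast
      obtain m2 where m2: "m2 \<in> M" "path_component ?X m2 b" using M(2) \<open>b \<in> T\<close> by blast
      have Un: "\<Omega> - T - path_image c = \<Omega> - ?T'" by auto
      show ?thesis
      proof (cases "m1 = m2")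
        case True
        then have "path_component ?X p b"
          using m1 m2 path_component_sym path_component_trans by blast
        moreover have "path_image c \<subseteq> (\<Omega> - T) \<union> ?X"
          using c(3) p \<open>q \<in> T\<close> by auto
        moreover have "(\<Omega> - T) \<inter> ?X = {}" using assms(4) by auto
        ultimately obtain \<W>' where "open_partition \<W>' (\<Omega> - T - path_image c)"
            "card \<W>' = Suc (card \<W>)"
          using open_partition_cut_by_crosscut [OF \<W> c(1) cX] c(2) b_def by metis
        then show ?thesis
          using M(1) span Un by (intro exI [of _ M] exI [of _ \<W>']) simp
      next
        case False
        have "path_component ?X' m1 m2"
          using path_component_trans [OF path_component_trans [OF mono [OF m1(2)]
              path_component_sym [OF bc [OF pc(1)]]] path_component_sym [OF mono [OF m2(2)]]] .
        then have "\<exists>m\<in>M - {m2}. path_component ?X' m x" if "x \<in> ?X'" for x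
          using span [OF that] m1(1) False path_component_trans by (metis Diff_iff singletonD)
        moreover have "card (M - {m2}) + 1 = card M"
          using M(1) m2(1) card_Suc_Diff1 by fastforce
        ultimately show ?thesis
          using open_partition_minus_arc [OF \<W> c(1)] M(1) Un
          by (intro exI [of _ "M - {m2}"] exI [of _ "(\<lambda>W. W - path_image c) ` \<W>"]) auto
      qed
    qed
    then obtain M' \<W>' where M': "finite M'" "\<forall>x\<in>?X'. \<exists>m\<in>M'. path_component ?X' m x"
        "open_partition \<W>' (\<Omega> - ?T')" "card M' + Suc (card \<W>) \<le> card M + card \<W>'"
      by blast
    moreover have "1 + card (insert p F) + card M' \<le> card \<W>' + card (D ` insert p F) + card M0"
      using card M'(4) DF by simp
    ultimately show ?thesis
      by (intro exI [of _ ?T'] exI [of _ M'] exI [of _ \<W>'] conjI)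
  qed
qed

section \<open>Faces\<close>

lemma open_partition_connected_subset:
  assumes "open_partition \<W> U" "W \<in> \<W>" "connected C" "C \<subseteq> U" "C \<inter> W \<noteq> {}"
  shows "C \<subseteq> W"
proof -
  have W: "pairwise disjnt \<W>" "\<Union>\<W> = U" "\<And>W. W \<in> \<W> \<Longrightarrow> open W"
    using assms by (auto simp: open_partition_def)
  have "W \<inter> \<Union>(\<W> - {W}) = {}"
    using W(1) assms(2) by (auto simp: pairwise_def disjnt_def)
  moreover have "open (\<Union>(\<W> - {W}))" "open W" "C \<subseteq> W \<union> \<Union>(\<W> - {W})"
    using W assms(2,4) by auto
  ultimately have "C \<inter> \<Union>(\<W> - {W}) = {}"
    using connectedD [OF assms(3), of W "\<Union>(\<W> - {W})"] assms(5) by blast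
  then show ?thesis using \<open>C \<subseteq> W \<union> \<Union>(\<W> - {W})\<close> by blast
qed

text \<open>A connected set that starts in \<open>\<Omega>\<close> and avoids its frontier cannot
  leave \<open>\<Omega>\<close>, hence stays within one face.\<close>

lemma open_partition_connected_component:
  assumes "open_partition \<W> (\<Omega> - T)" "W \<in> \<W>" "frontier \<Omega> \<subseteq> \<Gamma>" "x \<in> W"
    and "connected_component (- (\<Gamma> \<union> T)) x y"
  shows "y \<in> W"
proof -
  obtain C where C: "connected C" "C \<subseteq> - (\<Gamma> \<union> T)" "x \<in> C" "y \<in> C"
    using assms(5) by (auto simp: connected_component_def)
  have "x \<in> \<Omega>" using assms(1,2,4) by (auto simp: open_partition_def)
  then have "C \<subseteq> \<Omega>"
    using connected_Int_frontier [OF C(1), of \<Omega>] C assms(3) by blast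
  then show ?thesis
    using open_partition_connected_subset [OF assms(1,2) C(1)] C assms(4) by blast
qed

text \<open>
  If \<open>W\<close> did not touch \<open>\<Gamma>\<close> outside \<open>K \<union> T\<close>, its frontier would lie in \<open>K \<union> T\<close>, which does not separate
  points of \<open>\<Omega> - T\<close>; thus \<open>W\<close> would be all of \<open>\<Omega> - T\<close>.
\<close>

lemma face_touches_boundary:
  fixes \<Omega> T \<Gamma> K :: "complex set"
  assumes \<Omega>: "open \<Omega>" "connected \<Omega>" "frontier \<Omega> = \<Gamma>"
    and T: "compact T" "connected (- T)"
    and part: "open_partition \<W> (\<Omega> - T)" "W \<in> \<W>"
    and K: "closed K" "K \<subseteq> \<Gamma>" "K \<inter> T = {}" and "z \<in> \<Gamma> - (K \<union> T)"
  shows "closure W \<inter> (\<Gamma> - (K \<union> T)) \<noteq> {}"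
proof
  assume none: "closure W \<inter> (\<Gamma> - (K \<union> T)) = {}"
  have W: "open W" "W \<noteq> {}" "W \<subseteq> \<Omega> - T"
    using part by (auto simp: open_partition_def)
  have "\<Omega> \<inter> \<Gamma> = {}"
    using \<Omega>(1,3) by (auto simp: frontier_def interior_open)
  have "frontier W \<subseteq> K \<union> T"
  proof
    fix w assume "w \<in> frontier W"
    then have w: "w \<in> closure W" "w \<notin> W"
      using W(1) by (auto simp: frontier_def interior_open)
    show "w \<in> K \<union> T"
    proof (rule ccontr)
      assume nw: "w \<notin> K \<union> T"
      have "w \<in> closure \<Omega>" using w(1) W(3) closure_mono [of W \<Omega>] by auto
      moreover have "w \<notin> \<Gamma>" using none w(1) nw by blast
      ultimately have "w \<in> \<Omega> - T"
        using \<Omega>(3) nw by (metis Diff_iff UnCI \<Omega>(1) frontier_def interior_open)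
      \<comment> \<open>A point of \<open>\<Omega> - T\<close> outside \<open>W\<close> has another
        member of the partition as a neighbourhood, so it cannot lie in
        \<open>closure W\<close>.\<close>
      then obtain V where V: "V \<in> \<W>" "w \<in> V"
        using part(1) by (auto simp: open_partition_def)
      then have "open V" "V \<inter> W = {}"
        using w(2) part unfolding open_partition_def pairwise_def disjnt_def by blast+
      then show False
        using w(1) V(2) open_Int_closure_eq_empty by blast
    qed
  qed
  obtain x where x: "x \<in> W" using W(2) by blast
  have sub: "\<Omega> - T \<subseteq> W"
  proof
    fix y assume y: "y \<in> \<Omega> - T"
    have "connected_component (- (T \<union> K)) x y"
    proof (rule Janiszewski)
      show "connected (T \<inter> K)" using K(3) by (simp add: Int_commute)
      show "connected_component (- T) x y"
        using T(2) x y W(3) by (auto simp: connected_iff_connected_component)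
      show "connected_component (- K) x y"
        unfolding connected_component_def
        using \<Omega>(2) K(2) \<open>\<Omega> \<inter> \<Gamma> = {}\<close> x y W(3) by (intro exI [of _ \<Omega>]) auto
    qed (use T K in auto)
    then obtain C where C: "connected C" "C \<subseteq> - (T \<union> K)" "x \<in> C" "y \<in> C"
      by (auto simp: connected_component_def)
    then show "y \<in> W"
      using connected_Int_frontier [OF C(1), of W] x \<open>frontier W \<subseteq> K \<union> T\<close> by blast
  qed
  \<comment> \<open>\<open>z\<close> is a limit of points of \<open>\<Omega>\<close> and lies off
    the closed set \<open>T\<close>, so it is a limit of points of \<open>\<Omega> - T\<close>, all
    of which are in \<open>W\<close>.\<close>
  have "z \<in> closure \<Omega>" using assms(11) \<Omega>(3) by (auto simp: frontier_def)
  moreover have "open (- T)" "z \<in> - T"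
    using T(1) assms(11) by (auto simp: compact_imp_closed open_Compl)
  ultimately have "z \<in> closure (\<Omega> \<inter> - T)"
    using open_Int_closure_subset [of "- T" \<Omega>] by (auto simp: Int_commute)
  then have "z \<in> closure W"
    using sub closure_mono [of "\<Omega> \<inter> - T" W] by (auto simp: Diff_eq)
  then show False using none assms(11) by blast
qed

text \<open>
  \<open>S\<close> is the boundary curve containing the open arc \<open>I\<close>, and \<open>R\<close> is everything else. Two points of \<open>\<Omega>\<close>
  near \<open>I\<close> are separated neither by \<open>S\<close> nor by \<open>R\<close>, hence by Janiszewski's theorem not by \<open>S \<union> R\<close>.
\<close>

lemma face_spreads_along_arc:
  fixes \<Omega> T \<Gamma> S R I :: "complex set"
  assumes \<Omega>: "connected \<Omega>" "frontier \<Omega> \<subseteq> \<Gamma>"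
    and part: "open_partition \<W> (\<Omega> - T)" "W \<in> \<W>"
    and S: "compact S" "\<Omega> \<inter> S = {}" and R: "closed R" "connected (S \<inter> R)" "\<Gamma> \<union> T \<subseteq> S \<union> R"
    and I: "connected I" "I \<inter> R = {}" "q \<in> I" "v \<in> I"
    and q: "q \<in> closure W" and v: "v \<in> closure \<Omega>"
  shows "v \<in> closure W"
  unfolding closure_iff_nhds_not_empty
proof (intro allI impI)
  fix A V assume AV: "V \<subseteq> A" "open V" "v \<in> V"
  have W\<Omega>: "W \<subseteq> \<Omega>" using part by (auto simp: open_partition_def)
  \<comment> \<open>This component is open and contains \<open>I\<close>, so it reaches
    \<open>W\<close> near \<open>q\<close> and \<open>\<Omega>\<close> near \<open>v\<close>, and
    connects the two without crossing \<open>R\<close>.\<close>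
  define C where "C = connected_component_set (- R) v"
  have C: "open C" "connected C" "C \<subseteq> - R" "I \<subseteq> C"
    using R(1) I connected_component_maximal [of v I "- R"]
    by (auto simp: C_def open_connected_component open_Compl connected_component_subset
        dest: connected_component_in)
  obtain x where x: "x \<in> C" "x \<in> W"
    using q C(1,4) I(3) open_Int_closure_eq_empty [OF C(1), of W] by blast
  obtain y where y: "y \<in> C" "y \<in> V" "y \<in> \<Omega>"
    using v C(1,4) I(4) AV open_Int_closure_eq_empty [of "C \<inter> V" \<Omega>] by blast
  have "connected_component (- (S \<union> R)) x y"
  proof (rule Janiszewski)
    show "connected_component (- S) x y"
      unfolding connected_component_def using \<Omega>(1) S(2) x(2) W\<Omega> y(3) by blast
    show "connected_component (- R) x y"
      unfolding connected_component_def using C x(1) y(1) by blast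
  qed (use S R in auto)
  then have "connected_component (- (\<Gamma> \<union> T)) x y"
    by (rule connected_component_of_subset) (use R(3) in blast)
  then have "y \<in> W"
    using open_partition_connected_component [OF part \<Omega>(2) x(2)] by blast
  then show "W \<inter> A \<noteq> {}" using y AV by blast
qed

text \<open>The gap of \<open>Q\<close> around \<open>u\<close> becomes \<open>I\<close>, the rest
  of the loop \<open>J\<close>. Since \<open>0\<close> and \<open>1\<close> have the same image, the
  parameters before and after all of \<open>Q\<close> form one gap, so \<open>outer\<close> asks for
  a point of \<open>N\<close> on only one of these two sides.\<close>

lemma simple_loop_split_at_gap:
  fixes \<gamma> :: "real \<Rightarrow> complex"
  assumes \<gamma>: "simple_path \<gamma>" "pathfinish \<gamma> = pathstart \<gamma>"
    and Q: "finite Q" "Q \<noteq> {}" "Q \<subseteq> {0<..<1}" and N: "N \<subseteq> {0..1}"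
    and betw: "\<And>a b. a \<in> Q \<Longrightarrow> b \<in> Q \<Longrightarrow> a < b \<Longrightarrow> \<exists>v\<in>N. a < v \<and> v < b"
    and outer: "\<exists>v\<in>N. (\<forall>a\<in>Q. v < a) \<or> (\<forall>a\<in>Q. a < v)"
    and u: "u \<in> {0..1}" "u \<notin> Q"
  obtains I J v where "connected I" "connected J" "closed J" "I \<inter> J = {}" "I \<union> J = path_image \<gamma>"
    "\<gamma> ` Q \<subseteq> J" "\<gamma> u \<in> I" "v \<in> N" "\<gamma> v \<in> I"
proof -
  note result = that
  have cont: "continuous_on {0..1} \<gamma>" and inj: "\<And>x y. x \<in> {0..1} \<Longrightarrow> y \<in> {0..1} \<Longrightarrow> \<gamma> x = \<gamma> y \<Longrightarrow>
      x = y \<or> x = 0 \<and> y = 1 \<or> x = 1 \<and> y = 0"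
    using \<gamma>(1) by (auto simp: simple_path_def path_def loop_free_def)
  have loop: "\<gamma> 0 = \<gamma> 1" using \<gamma>(2) by (simp add: pathstart_def pathfinish_def)
  have conn: "connected (\<gamma> ` A)" if "connected A" "A \<subseteq> {0..1}" for A
    using connected_continuous_image cont continuous_on_subset that by blast
  have clos: "closed (\<gamma> ` A)" if "closed A" "A \<subseteq> {0..1}" for A
  proof -
    have "compact A" using that by (metis compact_Icc compact_Int_closed inf.absorb2)
    then show ?thesis
      using continuous_on_subset [OF cont that(2)] by (intro compact_imp_closed compact_continuous_image)
  qed
  \<comment> \<open>The condition on \<open>0\<close> and \<open>1\<close> makes \<open>A\<close>
    and \<open>B\<close> respect the only identification made by the loop, so their images are
    disjoint.\<close>
  have split: thesis
    if AB: "A \<union> B = {0..1}" "A \<inter> B = {}" "closed B" "connected (\<gamma> ` A)" "connected (\<gamma> ` B)"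
      "0 \<in> A \<longleftrightarrow> 1 \<in> A" "Q \<subseteq> B" "u \<in> A" "v \<in> N" "v \<in> A" for A B v
  proof (rule result)
    show "\<gamma> ` A \<inter> \<gamma> ` B = {}"
    proof (rule ccontr)
      assume "\<gamma> ` A \<inter> \<gamma> ` B \<noteq> {}"
      then obtain x y where xy: "x \<in> A" "y \<in> B" "\<gamma> x = \<gamma> y" by blast
      then have "x \<in> {0..1}" "y \<in> {0..1}" using AB(1) by blast+
      then show False using inj xy AB(2,6) by blast
    qed
    have "A \<subseteq> {0..1}" "B \<subseteq> {0..1}" using AB(1) by blast+
    then show "closed (\<gamma> ` B)" "\<gamma> ` A \<union> \<gamma> ` B = path_image \<gamma>"
      using clos [OF AB(3)] AB(1) by (auto simp: path_image_def)
  qed (use AB in auto)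
  have two: "connected (\<gamma> ` (A \<union> B))"
    if "connected A" "connected B" "A \<subseteq> {0..1}" "B \<subseteq> {0..1}" "0 \<in> A" "1 \<in> B" for A B
    unfolding image_Un using conn that loop by (intro connected_Un) auto
  show thesis
  proof (cases "(\<exists>a\<in>Q. a < u) \<and> (\<exists>b\<in>Q. u < b)")
    case True
    \<comment> \<open>\<open>a\<close> and \<open>b\<close> are the neighbours of \<open>u\<close>
      in \<open>Q\<close>, so the interval between them is a gap.\<close>
    define a where "a = Max {a\<in>Q. a < u}"
    define b where "b = Min {b\<in>Q. u < b}"
    have "{a\<in>Q. a < u} \<noteq> {}" "{b\<in>Q. u < b} \<noteq> {}"
      using True by auto
    then have "a \<in> {a\<in>Q. a < u}" "b \<in> {b\<in>Q. u < b}"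
      unfolding a_def b_def using Q(1) by (intro Max_in Min_in; simp)+
    then have a: "a \<in> Q" "a < u" and b: "b \<in> Q" "u < b" by auto
    have a': "\<And>x. x \<in> Q \<Longrightarrow> x < u \<Longrightarrow> x \<le> a" and b': "\<And>x. x \<in> Q \<Longrightarrow> u < x \<Longrightarrow> b \<le> x"
      using Q(1) by (auto simp: a_def b_def)
    have ab: "0 < a" "a < 1" "0 < b" "b < 1" using a(1) b(1) Q(3) by auto
    obtain v where "v \<in> N" "a < v" "v < b"
      using betw [OF a(1) b(1)] a b by auto
    moreover have "Q \<subseteq> {0..a} \<union> {b..1}"
    proof
      fix x assume x: "x \<in> Q"
      then have "x \<noteq> u" "0 < x" "x < 1" using u(2) Q(3) by auto
      then show "x \<in> {0..a} \<union> {b..1}" using a' [OF x] b' [OF x] by force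
    qed
    moreover have "connected (\<gamma> ` {a<..<b})" using ab by (intro conn) auto
    moreover have "connected (\<gamma> ` ({0..a} \<union> {b..1}))" using ab by (intro two) auto
    ultimately show thesis
      using ab a(2) b(2) by (intro split [of "{a<..<b}" "{0..a} \<union> {b..1}" v]) auto
  next
    case False
    define a where "a = Min Q"
    define b where "b = Max Q"
    have ab: "a \<in> Q" "b \<in> Q" "\<And>x. x \<in> Q \<Longrightarrow> a \<le> x \<and> x \<le> b"
      using Q(1,2) by (auto simp: a_def b_def)
    then have ab': "0 < a" "a < 1" "0 < b" "b < 1" "a \<le> b" using Q(3) by auto
    \<comment> \<open>Here \<open>u\<close> lies in the gap through the base point, made of the two
      end intervals.\<close>
    let ?A = "{0..<a} \<union> {b<..1}"
    have u': "u < a \<or> b < u"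
      using False ab u(2) by (metis linorder_neqE_linordered_idom)
    obtain v where v: "v \<in> N" "v < a \<or> b < v" using outer ab by blast
    show thesis
    proof (rule split)
      show "?A \<union> {a..b} = {0..1}" "?A \<inter> {a..b} = {}" "0 \<in> ?A \<longleftrightarrow> 1 \<in> ?A"
        using ab' by auto
      show "connected (\<gamma> ` ?A)" using ab' by (intro two) auto
      show "connected (\<gamma> ` {a..b})" using ab' by (intro conn) auto
      show "Q \<subseteq> {a..b}" using ab by auto
      show "u \<in> ?A" using u' u(1) by auto
      show "v \<in> ?A" using v N by auto
    qed (use v in auto)
  qed
qed

section \<open>Counting nodal domains\<close>

lemma closed_simple_path_inj:
  assumes "simple_path \<gamma>" "a \<in> {0<..<1}" "b \<in> {0..1}" "\<gamma> a = \<gamma> b"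
  shows "a = b"
proof -
  have "a \<in> {0..1}" "a \<noteq> 0" "a \<noteq> 1" using assms(2) by auto
  then show ?thesis
    using assms(1,3,4) unfolding simple_path_def loop_free_def by blast
qed

locale jordan_loop_domain =
  fixes \<Omega> :: "complex set" and g :: nat and \<gamma> :: "nat \<Rightarrow> real \<Rightarrow> complex"
    and f :: "complex \<Rightarrow> real"
  assumes open_dom: "open \<Omega>" and connected_dom: "connected \<Omega>"
    and loops: "\<And>i. i \<le> g \<Longrightarrow> simple_path (\<gamma> i) \<and> pathfinish (\<gamma> i) = pathstart (\<gamma> i)"
    and inj_loops: "inj_on (\<lambda>i. path_image (\<gamma> i)) {..g}"
    and components_frontier: "components (frontier \<Omega>) = (\<lambda>i. path_image (\<gamma> i)) ` {..g}"
    and continuous_f: "continuous_on (closure \<Omega>) f"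
    and finite_nodal_domains: "finite (nodal_domains f \<Omega>)"
begin

lemma frontier_eq: "frontier \<Omega> = (\<Union>i\<le>g. path_image (\<gamma> i))"
  using Union_components [of "frontier \<Omega>"] components_frontier by auto

lemma loops_disjoint:
  assumes "i \<le> g" "j \<le> g" "i \<noteq> j"
  shows "path_image (\<gamma> i) \<inter> path_image (\<gamma> j) = {}"
proof -
  have "path_image (\<gamma> i) \<noteq> path_image (\<gamma> j)"
    using inj_loops assms by (auto dest: inj_onD)
  moreover have "path_image (\<gamma> i) \<in> components (frontier \<Omega>)" "path_image (\<gamma> j) \<in> components (frontier \<Omega>)"
    using components_frontier assms by auto
  ultimately show ?thesis
    using components_nonoverlap by blast
qed

lemma dom_frontier_disjoint: "\<Omega> \<inter> frontier \<Omega> = {}"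
  using open_dom by (auto simp: frontier_def interior_open)

lemma compact_loop: "i \<le> g \<Longrightarrow> compact (path_image (\<gamma> i))"
  using loops by (simp add: compact_simple_path_image)

lemma path_image_subset_closure: "i \<le> g \<Longrightarrow> path_image (\<gamma> i) \<subseteq> closure \<Omega>"
  using frontier_eq by (auto simp: frontier_def)

text \<open>By continuity the nonzero set is open in \<open>\<Omega>\<close>, so taking the closure
  of the zero set removes no further point.\<close>

lemma mem_nonzero_set_iff:
  "z \<in> \<Omega> - closure {z \<in> \<Omega>. f z = 0} \<longleftrightarrow> z \<in> \<Omega> \<and> f z \<noteq> 0"
proof
  assume "z \<in> \<Omega> - closure {z \<in> \<Omega>. f z = 0}"
  then show "z \<in> \<Omega> \<and> f z \<noteq> 0" using closure_subset [of "{z \<in> \<Omega>. f z = 0}"] by auto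
next
  assume z: "z \<in> \<Omega> \<and> f z \<noteq> 0"
  have "continuous_on \<Omega> f" using continuous_f closure_subset continuous_on_subset by blast
  then have "open (\<Omega> \<inter> f -` (- {0}))"
    using open_dom by (intro continuous_open_preimage) auto
  moreover have "(\<Omega> \<inter> f -` (- {0})) \<inter> {z \<in> \<Omega>. f z = 0} = {}" by auto
  ultimately have "(\<Omega> \<inter> f -` (- {0})) \<inter> closure {z \<in> \<Omega>. f z = 0} = {}"
    using open_Int_closure_eq_empty by blast
  then show "z \<in> \<Omega> - closure {z \<in> \<Omega>. f z = 0}" using z by blast
qed

lemma nodal_domain:
  assumes "A \<in> nodal_domains f \<Omega>"
  shows "open A" "connected A" "A \<noteq> {}" "A \<subseteq> \<Omega>" "\<And>z. z \<in> A \<Longrightarrow> f z \<noteq> 0"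
proof -
  have "A \<subseteq> \<Omega> - closure {z \<in> \<Omega>. f z = 0}"
    using assms in_components_subset unfolding nodal_domains_def by blast
  then show "A \<subseteq> \<Omega>" "\<And>z. z \<in> A \<Longrightarrow> f z \<noteq> 0"
    using mem_nonzero_set_iff by blast+
  show "open A"
    using assms unfolding nodal_domains_def by (rule open_components [rotated]) (simp add: open_dom open_Diff)
  show "connected A" "A \<noteq> {}"
    using assms in_components_connected in_components_nonempty unfolding nodal_domains_def by blast+
qed

lemma nodal_domain_containing:
  assumes "connected C" "C \<noteq> {}" "C \<subseteq> \<Omega>" "\<And>z. z \<in> C \<Longrightarrow> f z \<noteq> 0"
  obtains A where "A \<in> nodal_domains f \<Omega>" "C \<subseteq> A"
proof -
  have "C \<subseteq> \<Omega> - closure {z \<in> \<Omega>. f z = 0}"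
    using mem_nonzero_set_iff assms(3,4) by blast
  then show thesis
    using exists_component_superset [of C] assms(1,2) that unfolding nodal_domains_def by blast
qed

lemma nodal_domain_sign:
  assumes "A \<in> nodal_domains f \<Omega>" "x \<in> A" "y \<in> A" "f x > 0"
  shows "f y > 0"
proof (rule ccontr)
  assume "\<not> f y > 0"
  have "continuous_on A f"
    using nodal_domain(4) [OF assms(1)] continuous_f closure_subset continuous_on_subset by blast
  then have "connected (f ` A)"
    using nodal_domain(2) [OF assms(1)] connected_continuous_image by blast
  then have "0 \<in> f ` A"
    using assms \<open>\<not> f y > 0\<close> connectedD_interval [of "f ` A" "f y" "f x" 0] by auto
  then show False using nodal_domain(5) [OF assms(1)] by auto
qed

lemma negative_near_negative_closure_point:
  assumes "z \<in> closure W" "W \<subseteq> \<Omega>" "f z < 0"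
  obtains y where "y \<in> W" "f y < 0"
proof -
  have "z \<in> closure \<Omega>" using assms(1,2) closure_mono by blast
  have "openin (top_of_set (closure \<Omega>)) (closure \<Omega> \<inter> f -` {..<0})"
    using continuous_f by (intro continuous_openin_preimage_gen) auto
  then obtain V where V: "open V" "closure \<Omega> \<inter> f -` {..<0} = closure \<Omega> \<inter> V"
    by (auto simp: openin_open)
  then have "z \<in> V" using \<open>z \<in> closure \<Omega>\<close> assms(3) by blast
  then obtain y where "y \<in> V" "y \<in> W"
    using V(1) assms(1) open_Int_closure_eq_empty by blast
  moreover then have "f y < 0" using V(2) assms(2) closure_subset by blast
  ultimately show thesis using that by blast
qed

end

text \<open>Keeping \<open>Q i\<close> inside the open unit interval keeps the base point of each
  loop out of it. \<open>Q_between\<close> covers the gaps between chosen points and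
  \<open>Q_outer\<close> the gap through the base point, so every gap contains a negative
  value.\<close>

locale interlaced_boundary_points = jordan_loop_domain +
  fixes Q :: "nat \<Rightarrow> real set"
  assumes finite_Q: "\<And>i. i \<le> g \<Longrightarrow> finite (Q i)"
    and Q_subset: "\<And>i. i \<le> g \<Longrightarrow> Q i \<subseteq> {0<..<1}"
    and Q_accessible: "\<And>i a. i \<le> g \<Longrightarrow> a \<in> Q i \<Longrightarrow>
      \<exists>A\<in>nodal_domains f \<Omega>. accessible A (\<gamma> i a) \<and> (\<forall>z\<in>A. f z > 0)"
    and Q_between: "\<And>i a b. i \<le> g \<Longrightarrow> a \<in> Q i \<Longrightarrow> b \<in> Q i \<Longrightarrow> a < b \<Longrightarrow>
      \<exists>v\<in>{v\<in>{0..1}. f (\<gamma> i v) < 0}. a < v \<and> v < b"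
    and Q_outer: "\<And>i. i \<le> g \<Longrightarrow> Q i \<noteq> {} \<Longrightarrow>
      \<exists>v\<in>{v\<in>{0..1}. f (\<gamma> i v) < 0}. (\<forall>a\<in>Q i. v < a) \<or> (\<forall>a\<in>Q i. a < v)"
begin

section \<open>Chosen boundary points and the faces of their forest\<close>

definition "points = (\<Union>i\<le>g. \<gamma> i ` Q i)"

lemma loop_in_points_iff:
  assumes "i \<le> g" "u \<in> {0..1}"
  shows "\<gamma> i u \<in> points \<longleftrightarrow> u \<in> Q i"
proof
  assume "\<gamma> i u \<in> points"
  then obtain j a where j: "j \<le> g" "a \<in> Q j" "\<gamma> i u = \<gamma> j a" by (auto simp: points_def)
  have "a \<in> {0<..<1}" using Q_subset j by blast
  then have "\<gamma> j a \<in> path_image (\<gamma> i)" "\<gamma> j a \<in> path_image (\<gamma> j)"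
    unfolding path_image_def using j(3) assms(2) by (metis imageI, auto)
  then have "j = i" using loops_disjoint [of i j] assms j by blast
  then have "a = u"
    using closed_simple_path_inj [of "\<gamma> i" a u] loops assms j \<open>a \<in> {0<..<1}\<close> by metis
  then show "u \<in> Q i" using j \<open>j = i\<close> by simp
qed (use assms in \<open>auto simp: points_def\<close>)

lemma finite_points: "finite points"
  using finite_Q by (auto simp: points_def)

lemma points_subset: "points \<subseteq> frontier \<Omega>"
proof -
  have "\<gamma> i ` Q i \<subseteq> path_image (\<gamma> i)" if "i \<le> g" for i
    using Q_subset [OF that] unfolding path_image_def by fastforce
  then show ?thesis by (auto simp: points_def frontier_eq)
qed

lemma card_points: "card points = (\<Sum>i\<le>g. card (Q i))"
proof -
  have "card points = (\<Sum>i\<le>g. card (\<gamma> i ` Q i))"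
    unfolding points_def
  proof (rule card_UN_disjoint)
    have "\<gamma> i ` Q i \<subseteq> path_image (\<gamma> i)" if "i \<le> g" for i
      using Q_subset [OF that] unfolding path_image_def by fastforce
    then show "\<forall>i\<in>{..g}. \<forall>j\<in>{..g}. i \<noteq> j \<longrightarrow> \<gamma> i ` Q i \<inter> \<gamma> j ` Q j = {}"
      using loops_disjoint by (metis (no_types, opaque_lifting) atMost_iff disjnt_def disjnt_subset1 disjnt_subset2)
  qed (use finite_Q in auto)
  moreover have "card (\<gamma> i ` Q i) = card (Q i)" if "i \<le> g" for i
  proof (rule card_image, rule inj_onI)
    fix a b assume "a \<in> Q i" "b \<in> Q i" "\<gamma> i a = \<gamma> i b"
    moreover have "Q i \<subseteq> {0..1}" using Q_subset [OF that] by auto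
    ultimately show "a = b"
      using closed_simple_path_inj [of "\<gamma> i" a b] loops Q_subset that by blast
  qed
  ultimately show ?thesis by simp
qed

text \<open>A face touches a loop that carries chosen points, spreads along the gap there up to a
  negative boundary value, and takes negative values itself by continuity.\<close>

lemma face_meets_negative_set:
  assumes T: "compact T" "connected (- T)" "T \<inter> frontier \<Omega> = points"
    and part: "open_partition \<W> (\<Omega> - T)" "W \<in> \<W>" and ne: "points \<noteq> {}"
  shows "\<exists>y\<in>W. f y < 0"
proof -
  have W\<Omega>: "W \<subseteq> \<Omega>" using part by (auto simp: open_partition_def)
  \<comment> \<open>Loops without chosen points come with no negative value, so contact with them
    must be excluded.\<close>
  define K where "K = (\<Union>i\<in>{i. i \<le> g \<and> Q i = {}}. path_image (\<gamma> i))"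
  have in_T: "\<gamma> i u \<in> T \<longleftrightarrow> u \<in> Q i" if "i \<le> g" "u \<in> {0..1}" for i u
  proof -
    have "\<gamma> i u \<in> frontier \<Omega>"
      unfolding frontier_eq path_image_def using that by blast
    then show ?thesis using T(3) loop_in_points_iff [OF that] by blast
  qed
  have "closed K"
    unfolding K_def using compact_loop by (intro closed_UN) (auto intro: compact_imp_closed)
  moreover have "K \<subseteq> frontier \<Omega>" by (auto simp: K_def frontier_eq)
  moreover have "K \<inter> T = {}"
    using in_T by (auto simp: K_def path_image_def)
  moreover obtain i0 where i0: "i0 \<le> g" "Q i0 \<noteq> {}" using ne by (auto simp: points_def)
  \<comment> \<open>The base point of a loop that carries chosen points witnesses that the frontier
    is not exhausted by \<open>K \<union> T\<close>.\<close>
  moreover have "\<gamma> i0 0 \<in> frontier \<Omega> - (K \<union> T)"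
  proof -
    have "\<gamma> i0 0 \<in> path_image (\<gamma> i0)" by (auto simp: path_image_def)
    moreover have "0 \<notin> Q i0" using Q_subset [OF i0(1)] by auto
    then have "\<gamma> i0 0 \<notin> T" using in_T [OF i0(1), of 0] by simp
    moreover have "\<gamma> i0 0 \<notin> K"
    proof
      assume "\<gamma> i0 0 \<in> K"
      then obtain j where "j \<le> g" "Q j = {}" "\<gamma> i0 0 \<in> path_image (\<gamma> j)" by (auto simp: K_def)
      then show False
        using loops_disjoint [OF i0(1), of j] i0 \<open>\<gamma> i0 0 \<in> path_image (\<gamma> i0)\<close> by auto
    qed
    ultimately show ?thesis using i0(1) by (auto simp: frontier_eq)
  qed
  ultimately obtain q where q: "q \<in> closure W" "q \<in> frontier \<Omega>" "q \<notin> K" "q \<notin> T"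
    using face_touches_boundary [OF open_dom connected_dom refl T(1,2) part] by blast
  then obtain i where i: "i \<le> g" "q \<in> path_image (\<gamma> i)" by (auto simp: frontier_eq)
  then have "Q i \<noteq> {}" using q(3) by (auto simp: K_def)
  obtain u where "u \<in> {0..1}" "q = \<gamma> i u"
    using i(2) by (auto simp: path_image_def)
  note i = i(1) this \<open>Q i \<noteq> {}\<close>
  have "u \<notin> Q i" using in_T [OF i(1,2)] i(3) q(4) by simp
  obtain I J v where IJ: "connected I" "connected J" "closed J" "I \<inter> J = {}"
      "I \<union> J = path_image (\<gamma> i)" "\<gamma> i ` Q i \<subseteq> J" "\<gamma> i u \<in> I"
      "v \<in> {v\<in>{0..1}. f (\<gamma> i v) < 0}" "\<gamma> i v \<in> I"
  proof (rule simple_loop_split_at_gap [of "\<gamma> i" "Q i" "{v\<in>{0..1}. f (\<gamma> i v) < 0}" u])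
    show "\<exists>v\<in>{v\<in>{0..1}. f (\<gamma> i v) < 0}. a < v \<and> v < b" if "a \<in> Q i" "b \<in> Q i" "a < b" for a b
      using Q_between [OF i(1) that] .
    show "\<exists>v\<in>{v\<in>{0..1}. f (\<gamma> i v) < 0}. (\<forall>a\<in>Q i. v < a) \<or> (\<forall>a\<in>Q i. a < v)"
      using Q_outer [OF i(1,4)] .
  qed (use i \<open>u \<notin> Q i\<close> loops finite_Q Q_subset in auto)
  define L where "L = (\<Union>j\<in>{..g} - {i}. path_image (\<gamma> j))"
  \<comment> \<open>\<open>R\<close> collects the frontier and the forest apart from the gap
    \<open>I\<close>. The loop meets it exactly in the connected set \<open>J\<close>, as
    Janiszewski's theorem requires.\<close>
  define R where "R = T \<union> J \<union> L"
  have "L \<inter> path_image (\<gamma> i) = {}"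
    unfolding L_def using loops_disjoint [OF i(1)] by blast
  moreover have "T \<inter> path_image (\<gamma> i) \<subseteq> J"
    using in_T [OF i(1)] IJ(6) by (auto simp: path_image_def)
  ultimately have "path_image (\<gamma> i) \<inter> R = J" "I \<inter> R = {}"
    using IJ(4,5) unfolding R_def by blast+
  have "closed L"
    unfolding L_def using compact_loop by (intro closed_UN) (auto intro: compact_imp_closed)
  have "\<gamma> i v \<in> closure W"
  proof (rule face_spreads_along_arc [OF connected_dom order_refl part])
    show "compact (path_image (\<gamma> i))" using compact_loop i(1) by blast
    show "\<Omega> \<inter> path_image (\<gamma> i) = {}"
      using dom_frontier_disjoint i(1) by (auto simp: frontier_eq)
    show "closed R"
      unfolding R_def using T(1) IJ(3) \<open>closed L\<close> by (auto intro: compact_imp_closed)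
    show "connected (path_image (\<gamma> i) \<inter> R)"
      using \<open>path_image (\<gamma> i) \<inter> R = J\<close> IJ(2) by simp
    show "frontier \<Omega> \<union> T \<subseteq> path_image (\<gamma> i) \<union> R"
      by (auto simp: frontier_eq R_def L_def)
    show "q \<in> I" using IJ(7) i(3) by simp
    show "\<gamma> i v \<in> closure \<Omega>"
      using path_image_subset_closure [OF i(1)] IJ(5,9) by blast
  qed (use IJ q \<open>I \<inter> R = {}\<close> in auto)
  then show ?thesis
    using negative_near_negative_closure_point [OF _ W\<Omega>] IJ(8) by blast
qed

text \<open>Distinct faces contain distinct negative nodal domains, none of them among the positive
  ones chosen by \<open>D\<close>, so the two kinds together are at most all nodal domains. The
  forest inequality with \<open>card M0 \<le> Suc g\<close> and \<open>1 \<le> card M\<close> gives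
  the bound.\<close>

theorem card_points_less:
  assumes "points \<noteq> {}"
  shows "Suc (card points) \<le> card (nodal_domains f \<Omega>) + g"
proof -
  let ?N = "nodal_domains f \<Omega>"
  have "\<forall>p\<in>points. \<exists>A. A \<in> ?N \<and> accessible A p \<and> (\<forall>z\<in>A. f z > 0)"
    using Q_accessible unfolding points_def by blast
  then obtain D where D: "\<And>p. p \<in> points \<Longrightarrow> D p \<in> ?N \<and> accessible (D p) p \<and> (\<forall>z\<in>D p. f z > 0)"
    by metis
  define M0 where "M0 = (\<lambda>i. \<gamma> i 0) ` {..g}"
  have "card M0 \<le> Suc g"
    unfolding M0_def using card_image_le [of "{..g}"] by simp
  have "\<exists>T M \<W>. compact T \<and> connected (- T) \<and> T \<inter> frontier \<Omega> = points \<and>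
      T \<subseteq> points \<union> \<Union>(D ` points) \<and> finite M \<and>
      (\<forall>x\<in>frontier \<Omega> \<union> T. \<exists>m\<in>M. path_component (frontier \<Omega> \<union> T) m x) \<and>
      open_partition \<W> (\<Omega> - T) \<and>
      1 + card points + card M \<le> card \<W> + card (D ` points) + card M0"
  proof (rule accessible_forest)
    show "\<exists>m\<in>M0. path_component (frontier \<Omega>) m x" if "x \<in> frontier \<Omega>" for x
    proof -
      obtain i where i: "i \<le> g" "x \<in> path_image (\<gamma> i)" using \<open>x \<in> frontier \<Omega>\<close> by (auto simp: frontier_eq)
      have "path_connected (path_image (\<gamma> i))"
        using loops i(1) simple_path_imp_path path_connected_path_image by blast
      then have "path_component (path_image (\<gamma> i)) (\<gamma> i 0) x"
        using i(2) pathstart_in_path_image [of "\<gamma> i"]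
        by (simp add: path_connected_component pathstart_def)
      then have "path_component (frontier \<Omega>) (\<gamma> i 0) x"
        by (rule path_component_of_subset [rotated]) (use i(1) frontier_eq in auto)
      then show ?thesis using i(1) by (auto simp: M0_def)
    qed
    show "\<Omega> \<noteq> {}" using points_subset assms by auto
    show "\<forall>p\<in>points. open (D p) \<and> connected (D p) \<and> D p \<subseteq> \<Omega> \<and> accessible (D p) p"
      using D nodal_domain by blast
    show "\<forall>p\<in>points. \<forall>q\<in>points. D p = D q \<or> D p \<inter> D q = {}"
      using D components_nonoverlap unfolding nodal_domains_def by blast
  qed (use open_dom dom_frontier_disjoint finite_points points_subset M0_def in auto)
  then obtain T M \<W> where T: "compact T" "connected (- T)" "T \<inter> frontier \<Omega> = points"
      "T \<subseteq> points \<union> \<Union>(D ` points)"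
    and M: "finite M" "\<forall>x\<in>frontier \<Omega> \<union> T. \<exists>m\<in>M. path_component (frontier \<Omega> \<union> T) m x"
    and \<W>: "open_partition \<W> (\<Omega> - T)"
    and card: "1 + card points + card M \<le> card \<W> + card (D ` points) + card M0"
    by (elim exE conjE) (rule that)
  have "M \<noteq> {}" using M(2) points_subset assms by blast
  then have "1 \<le> card M" using M(1) by (simp add: Suc_leI card_gt_0_iff)
  have "\<exists>A\<in>?N - D ` points. A \<subseteq> W" if W: "W \<in> \<W>" for W
  proof -
    obtain y where y: "y \<in> W" "f y < 0"
      using face_meets_negative_set [OF T(1-3) \<W> W assms] by blast
    have "y \<in> \<Omega>" using \<W> W y by (auto simp: open_partition_def)
    then obtain A where A: "A \<in> ?N" "y \<in> A"
      using nodal_domain_containing [of "{y}"] y(2) by auto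
    have neg: "f z < 0" if "z \<in> A" for z
      using nodal_domain_sign [OF A(1) that A(2)] nodal_domain(5) [OF A(1) that] y(2) by fastforce
    \<comment> \<open>The forest lies in the frontier and in positive domains, so a negative domain
      misses it and stays in one face.\<close>
    have "A \<inter> T = {}"
    proof (rule ccontr)
      assume "A \<inter> T \<noteq> {}"
      then obtain z where z: "z \<in> A" "z \<in> T" by blast
      then have "z \<notin> points"
        using points_subset dom_frontier_disjoint nodal_domain(4) [OF A(1)] by blast
      then obtain p where "p \<in> points" "z \<in> D p" using z T(4) by blast
      then show False using D neg [OF z(1)] by fastforce
    qed
    then have "A \<subseteq> W"
      using open_partition_connected_subset [OF \<W> W nodal_domain(2) [OF A(1)]]
        nodal_domain(4) [OF A(1)] y(1) A(2) by blast
    moreover have "A \<notin> D ` points"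
      using D neg A(2) by fastforce
    ultimately show ?thesis using A(1) by blast
  qed
  then obtain h where h: "\<And>W. W \<in> \<W> \<Longrightarrow> h W \<in> ?N - D ` points \<and> h W \<subseteq> W"
    by metis
  have "inj_on h \<W>"
  proof (rule inj_onI)
    fix V W assume VW: "V \<in> \<W>" "W \<in> \<W>" "h V = h W"
    have "h V \<noteq> {}" using h [OF VW(1)] nodal_domain(3) by blast
    then have "\<not> disjnt V W" using h [OF VW(1)] h [OF VW(2)] VW(3) by (auto simp: disjnt_def)
    then show "V = W" using \<W> VW by (auto simp: open_partition_def pairwise_def)
  qed
  then have "card \<W> \<le> card (?N - D ` points)"
    using h finite_nodal_domains by (intro card_inj_on_le) auto
  moreover have "D ` points \<subseteq> ?N" using D by blast
  then have "card (?N - D ` points) + card (D ` points) = card ?N"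
    using finite_nodal_domains finite_points
    by (simp add: card_Diff_subset card_mono)
  ultimately show ?thesis
    using card \<open>1 \<le> card M\<close> \<open>card M0 \<le> Suc g\<close> by simp
qed

end

section \<open>Choosing the boundary points\<close>

text \<open>Inserting \<open>0\<close> covers the empty set, whose supremum in \<open>enat\<close>
  is \<open>0\<close>.\<close>

lemma Sup_enat_image_finite:
  assumes "finite X"
  shows "Sup (enat ` X) = enat (Max (insert 0 X))"
proof (cases "X = {}")
  case False
  have "Max (enat ` X) = enat (Max X)"
    using assms False by (intro mono_Max_commute [symmetric] monoI) auto
  moreover have "Max (insert 0 X) = Max X"
    using assms False by simp
  ultimately show ?thesis
    using assms False by (simp add: Sup_enat_def)
qed (simp add: Sup_enat_def zero_enat_def)

lemma sum_enat: "(\<Sum>i\<in>A. enat (h i)) = enat (\<Sum>i\<in>A. h i)"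
  by (induction A rule: infinite_finite_induct) (auto simp: zero_enat_def)

text \<open>The condition in \<open>sign_changes\<close> without \<open>m \<ge> 2\<close>:
  \<open>m = 0\<close> holds vacuously and serves loops without sign changes, while
  \<open>m = 1\<close> would make a square negative.\<close>

definition sign_change_sequence :: "(complex \<Rightarrow> real) \<Rightarrow> (real \<Rightarrow> complex) \<Rightarrow> nat \<Rightarrow> (nat \<Rightarrow> real) \<Rightarrow> bool" where
  "sign_change_sequence f p m t \<longleftrightarrow>
     strict_mono_on {..<m} t \<and> (\<forall>k<m. t k \<in> {0..<1}) \<and>
     (\<forall>k<m. f (p (t k)) \<noteq> 0) \<and> (\<forall>k<m. f (p (t k)) * f (p (t (Suc k mod m))) < 0)"

text \<open>The cyclic successor maps positive indices injectively to negative ones and negative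
  ones to positive ones, so there are equally many of each.\<close>

lemma card_positive_sign_change_sequence:
  assumes "sign_change_sequence f p m t"
  shows "m = 2 * card {k. k < m \<and> f (p (t k)) > 0}"
proof (cases "m = 0")
  case False
  let ?P = "{k. k < m \<and> f (p (t k)) > 0}" and ?N = "{k. k < m \<and> f (p (t k)) < 0}"
  let ?s = "\<lambda>k. Suc k mod m"
  have inj: "inj_on ?s {..<m}"
  proof (rule inj_onI)
    fix a b assume "a \<in> {..<m}" "b \<in> {..<m}" "Suc a mod m = Suc b mod m"
    then show "a = b" by (auto simp: mod_Suc split: if_splits)
  qed
  have alt: "f (p (t k)) * f (p (t (?s k))) < 0" if "k < m" for k
    using assms that by (simp add: sign_change_sequence_def)
  have lt: "?s k < m" for k using False by simp
  have "?s ` ?P \<subseteq> ?N" "?s ` ?N \<subseteq> ?P"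
    using alt lt by (auto simp: mult_less_0_iff) (metis order_less_asym)+
  moreover have "inj_on ?s ?P" "inj_on ?s ?N"
    by (rule inj_on_subset [OF inj]; auto)+
  ultimately have "card ?P \<le> card ?N" "card ?N \<le> card ?P"
    by (auto intro!: card_inj_on_le [of ?s])
  moreover have "?P \<union> ?N = {..<m}"
    using assms by (auto simp: sign_change_sequence_def)
  moreover have "card (?P \<union> ?N) = card ?P + card ?N"
    by (rule card_Un_disjoint) auto
  ultimately show ?thesis by simp
qed simp

section \<open>Moving positive boundary points to accessible ones\<close>

context jordan_loop_domain
begin

lemma continuous_on_loop:
  assumes "i \<le> g"
  shows "continuous_on {0..1} (\<lambda>u. f (\<gamma> i u))"
proof -
  have "continuous_on {0..1} (\<gamma> i)"
    using loops [OF assms] simple_path_imp_path path_def by blast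
  moreover have "\<gamma> i ` {0..1} \<subseteq> closure \<Omega>"
    using path_image_subset_closure [OF assms] by (simp add: path_image_def)
  ultimately show ?thesis
    using continuous_on_compose2 [OF continuous_f] by blast
qed

text \<open>The image of \<open>U\<close> is relatively open in the frontier, because the rest of
  the loop and the other loops form a closed set. Density of accessible points gives an arc in
  \<open>\<Omega>\<close> ending there, and a final piece of it, where \<open>f\<close> is positive,
  lies in one nodal domain.\<close>

lemma accessible_point_dense:
  assumes i: "i \<le> g" and U: "open U" "U \<noteq> {}" "U \<subseteq> {0<..<1}"
    and pos: "\<And>u. u \<in> U \<Longrightarrow> f (\<gamma> i u) > 0"
  shows "\<exists>u\<in>U. \<exists>A\<in>nodal_domains f \<Omega>. accessible A (\<gamma> i u) \<and> (\<forall>z\<in>A. f z > 0)"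
proof -
  define L where "L = (\<Union>j\<in>{..g} - {i}. path_image (\<gamma> j))"
  have "closed L"
    unfolding L_def using compact_loop by (intro closed_UN) (auto intro: compact_imp_closed)
  have "compact (\<gamma> i ` ({0..1} - U))"
  proof (rule compact_continuous_image)
    show "continuous_on ({0..1} - U) (\<gamma> i)"
      using loops [OF i] simple_path_imp_path path_def continuous_on_subset by (metis Diff_subset)
    show "compact ({0..1} - U)" using U(1) by (simp add: compact_diff)
  qed
  then have cl: "closed (\<gamma> i ` ({0..1} - U) \<union> L)"
    using \<open>closed L\<close> by (auto intro: compact_imp_closed)
  have "\<gamma> i ` U = frontier \<Omega> \<inter> - (\<gamma> i ` ({0..1} - U) \<union> L)"
  proof (intro equalityI subsetI)
    fix z assume "z \<in> \<gamma> i ` U"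
    then obtain u where u: "u \<in> U" "z = \<gamma> i u" by blast
    then have "u \<in> {0<..<1}" using U(3) by blast
    then have z: "z \<in> path_image (\<gamma> i)" using u(2) by (auto simp: path_image_def)
    then have "z \<notin> L" unfolding L_def using loops_disjoint [OF i] by blast
    moreover have "z \<notin> \<gamma> i ` ({0..1} - U)"
    proof
      assume "z \<in> \<gamma> i ` ({0..1} - U)"
      then obtain v where v: "v \<in> {0..1}" "v \<notin> U" "\<gamma> i u = \<gamma> i v" using u(2) by auto
      then have "u = v"
        using closed_simple_path_inj [OF _ \<open>u \<in> {0<..<1}\<close>] loops [OF i] by metis
      then show False using u(1) v(2) by simp
    qed
    ultimately show "z \<in> frontier \<Omega> \<inter> - (\<gamma> i ` ({0..1} - U) \<union> L)"
      using z i by (auto simp: frontier_eq)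
  next
    fix z assume z: "z \<in> frontier \<Omega> \<inter> - (\<gamma> i ` ({0..1} - U) \<union> L)"
    then have "z \<in> path_image (\<gamma> i)" by (auto simp: frontier_eq L_def)
    then show "z \<in> \<gamma> i ` U" using z by (auto simp: path_image_def)
  qed
  then have "openin (top_of_set (frontier \<Omega>)) (\<gamma> i ` U)"
    using cl by (metis open_Compl openin_open_Int)
  then obtain h where h: "arc h" "h ` {0..<1} \<subseteq> \<Omega>" "pathfinish h \<in> \<gamma> i ` U"
    using dense_accessible_frontier_points [OF open_dom] U(2) by (metis image_is_empty)
  obtain u where u: "u \<in> U" "h 1 = \<gamma> i u" using h(3) by (auto simp: pathfinish_def)
  have fpos: "f (h 1) > 0" using pos u by simp
  have "{0..1::real} = insert 1 {0..<1}" by auto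
  moreover have "h 1 \<in> closure \<Omega>"
    using u U(3) path_image_subset_closure [OF i] by (fastforce simp: path_image_def)
  ultimately have "h ` {0..1} \<subseteq> closure \<Omega>"
    using h(2) closure_subset by auto
  moreover have hc: "continuous_on {0..1} h" using h(1) by (simp add: arc_def path_def)
  ultimately have "continuous_on {0..1} (\<lambda>s. f (h s))"
    using continuous_on_compose2 [OF continuous_f] by blast
  then obtain d where d: "d > 0" "\<And>s. s \<in> {0..1} \<Longrightarrow> dist s 1 < d \<Longrightarrow> dist (f (h s)) (f (h 1)) < f (h 1)"
    using fpos unfolding continuous_on_iff by (metis atLeastAtMost_iff order_refl zero_le_one)
  \<comment> \<open>The maximum with \<open>1/2\<close> keeps \<open>e\<close> positive. From
    \<open>e\<close> on, \<open>s\<close> is within \<open>d\<close> of \<open>1\<close>, so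
    \<open>f (h s)\<close> differs from \<open>f (h 1)\<close> by less than \<open>f (h 1)\<close>
    and is positive.\<close>
  define e where "e = max (1/2) (1 - d/2)"
  have e: "0 < e" "e < 1" using d(1) by (auto simp: e_def)
  have epos: "f (h s) > 0" if "s \<in> {e..<1}" for s
  proof -
    have "dist s 1 < d" using that d(1) by (auto simp: e_def dist_real_def)
    then show ?thesis using d(2) [of s] that e by (auto simp: dist_real_def abs_if split: if_splits)
  qed
  have "connected (h ` {e..<1})"
    using e by (intro connected_continuous_image continuous_on_subset [OF hc]) auto
  moreover have "h ` {e..<1} \<subseteq> \<Omega>" using h(2) e by auto
  moreover have "h ` {e..<1} \<noteq> {}" using e by auto
  moreover have "f z \<noteq> 0" if "z \<in> h ` {e..<1}" for z using that epos by fastforce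
  ultimately obtain A where A: "A \<in> nodal_domains f \<Omega>" "h ` {e..<1} \<subseteq> A"
    using nodal_domain_containing by blast
  have "h e \<in> A" "f (h e) > 0" using A(2) epos e by auto
  then have "\<forall>z\<in>A. f z > 0" using nodal_domain_sign [OF A(1)] by blast
  moreover have "accessible A (\<gamma> i u)"
    unfolding accessible_def
  proof (intro exI conjI)
    show "path (subpath e 1 h)" using h(1) e by (simp add: arc_imp_path)
    show "pathfinish (subpath e 1 h) = \<gamma> i u" using u by simp
    show "subpath e 1 h ` {0..<1} \<subseteq> A"
    proof
      fix z assume "z \<in> subpath e 1 h ` {0..<1}"
      then obtain s where s: "0 \<le> s" "s < 1" "z = h ((1 - e) * s + e)"
        by (auto simp: subpath_def)
      have "0 \<le> (1 - e) * s" "(1 - e) * s < 1 - e"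
        using s e mult_strict_left_mono [of s 1 "1 - e"] by auto
      then have "e \<le> (1 - e) * s + e" "(1 - e) * s + e < 1" by linarith+
      then have "(1 - e) * s + e \<in> {e..<1}" by simp
      then show "z \<in> A" using A(2) s(3) by blast
    qed
  qed
  ultimately show ?thesis using A(1) u(1) by blast
qed

text \<open>Each positive sample is moved slightly to an accessible point, while the negative
  samples stay put and keep separating the moved points.\<close>

lemma accessible_interlacing_set:
  assumes i: "i \<le> g" and t: "sign_change_sequence f (\<gamma> i) m t"
  shows "\<exists>Q. finite Q \<and> Q \<subseteq> {0<..<1} \<and> m = 2 * card Q \<and>
    (\<forall>a\<in>Q. \<exists>A\<in>nodal_domains f \<Omega>. accessible A (\<gamma> i a) \<and> (\<forall>z\<in>A. f z > 0)) \<and>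
    (\<forall>a\<in>Q. \<forall>b\<in>Q. a < b \<longrightarrow> (\<exists>v\<in>{v\<in>{0..1}. f (\<gamma> i v) < 0}. a < v \<and> v < b)) \<and>
    (Q \<noteq> {} \<longrightarrow> (\<exists>v\<in>{v\<in>{0..1}. f (\<gamma> i v) < 0}. (\<forall>a\<in>Q. v < a) \<or> (\<forall>a\<in>Q. a < v)))"
proof -
  let ?F = "\<lambda>u. f (\<gamma> i u)"
  let ?P = "{k. k < m \<and> ?F (t k) > 0}"
  have mono: "strict_mono_on {..<m} t" and t01: "\<And>k. k < m \<Longrightarrow> t k \<in> {0..<1}"
    and nz: "\<And>k. k < m \<Longrightarrow> ?F (t k) \<noteq> 0"
    and alt: "\<And>k. k < m \<Longrightarrow> ?F (t k) * ?F (t (Suc k mod m)) < 0"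
    using t by (auto simp: sign_change_sequence_def)
  have tless: "t j < t k" if "j < k" "k < m" for j k
    using mono that by (auto simp: strict_mono_on_def)
  \<comment> \<open>The new parameter \<open>a\<close> stays on the same side of every other sample
    as \<open>t k\<close>.\<close>
  let ?C = "\<lambda>k a. a \<in> {0<..<1} \<and> (\<forall>j<m. (t j < t k \<longrightarrow> t j < a) \<and> (t k < t j \<longrightarrow> a < t j)) \<and>
      (\<exists>A\<in>nodal_domains f \<Omega>. accessible A (\<gamma> i a) \<and> (\<forall>z\<in>A. f z > 0))"
  have "\<exists>a. ?C k a" if k: "k \<in> ?P" for k
  proof -
    have "openin (top_of_set {0..1}) ({0..1} \<inter> ?F -` {0<..})"
      using continuous_on_loop [OF i] by (intro continuous_openin_preimage_gen) auto
    then obtain V where V: "open V" "{0..1} \<inter> ?F -` {0<..} = {0..1} \<inter> V"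
      by (auto simp: openin_open)
    define B where "B = (\<Inter>j\<in>{j. j < m \<and> t j < t k}. {t j<..}) \<inter> (\<Inter>j\<in>{j. j < m \<and> t k < t j}. {..<t j})"
    have "open B" unfolding B_def by (intro open_Int open_INT) auto
    have tk: "t k \<in> {0..1}" using t01 [of k] k by auto
    then have "t k \<in> {0..1} \<inter> ?F -` {0<..}" using k by simp
    then have "t k \<in> V \<inter> B" unfolding V(2) by (simp add: B_def)
    \<comment> \<open>\<open>t k\<close> may be \<open>0\<close>, so it is only known to lie in the
      closure of the open interval; its neighbourhood \<open>V \<inter> B\<close> still meets that
      interval.\<close>
    moreover have "t k \<in> closure {0<..<1}" using tk by simp
    ultimately have "V \<inter> B \<inter> {0<..<1} \<noteq> {}"
      using V(1) \<open>open B\<close> open_Int_closure_eq_empty [of "V \<inter> B"] by blast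
    moreover have "open (V \<inter> B \<inter> {0<..<1})" using V(1) \<open>open B\<close> by auto
    moreover have "?F u > 0" if "u \<in> V \<inter> B \<inter> {0<..<1}" for u
    proof -
      have "u \<in> {0..1} \<inter> V" using that by auto
      then have "u \<in> {0..1} \<inter> ?F -` {0<..}" unfolding V(2) .
      then show ?thesis by simp
    qed
    ultimately obtain a where a: "a \<in> V \<inter> B \<inter> {0<..<1}"
      "\<exists>A\<in>nodal_domains f \<Omega>. accessible A (\<gamma> i a) \<and> (\<forall>z\<in>A. f z > 0)"
      using accessible_point_dense [OF i, of "V \<inter> B \<inter> {0<..<1}"] by blast
    then show ?thesis by (intro exI [of _ a]) (auto simp: B_def)
  qed
  then have "\<forall>k\<in>?P. \<exists>a. ?C k a" by blast
  from bchoice [OF this] obtain a where C: "\<forall>k\<in>?P. ?C k (a k)" ..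
  have a: "a k \<in> {0<..<1}"
    and below: "\<And>j. j < m \<Longrightarrow> t j < t k \<Longrightarrow> t j < a k"
    and above: "\<And>j. j < m \<Longrightarrow> t k < t j \<Longrightarrow> a k < t j"
    and acc: "\<exists>A\<in>nodal_domains f \<Omega>. accessible A (\<gamma> i (a k)) \<and> (\<forall>z\<in>A. f z > 0)"
    if "k \<in> ?P" for k
    using bspec [OF C that] by (elim conjE; simp)+
  have sep: "\<exists>v\<in>{v\<in>{0..1}. ?F v < 0}. a k < v \<and> v < a l" if "k \<in> ?P" "l \<in> ?P" "k < l" for k l
  proof -
    have lm: "l < m" using that by simp
    then have "Suc k < m" using that by simp
    then have neg: "?F (t (Suc k)) < 0"
      using alt [of k] that by (auto simp: mult_less_0_iff)
    then have "Suc k \<noteq> l" using that(2) by auto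
    then have "Suc k < l" using that(3) by simp
    then have "a k < t (Suc k)" "t (Suc k) < a l"
      using above [OF that(1) \<open>Suc k < m\<close>] below [OF that(2) \<open>Suc k < m\<close>] tless \<open>Suc k < m\<close> lm by auto
    moreover have "t (Suc k) \<in> {0..1}" using t01 [OF \<open>Suc k < m\<close>] by auto
    ultimately show ?thesis using neg by blast
  qed
  have ord: "a k < a l" if "k \<in> ?P" "l \<in> ?P" "k < l" for k l
    using sep [OF that] by auto
  have "inj_on a ?P"
  proof (rule inj_onI)
    fix k l assume kl: "k \<in> ?P" "l \<in> ?P" "a k = a l"
    show "k = l"
      using ord [OF kl(1,2)] ord [OF kl(2,1)] kl(3) by (cases k l rule: linorder_cases) auto
  qed
  then have "m = 2 * card (a ` ?P)"
    using card_positive_sign_change_sequence [OF t] by (simp add: card_image)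
  moreover have "\<exists>v\<in>{v\<in>{0..1}. ?F v < 0}. x < v \<and> v < y"
    if xy: "x \<in> a ` ?P" "y \<in> a ` ?P" "x < y" for x y
  proof -
    obtain k l where kl: "k \<in> ?P" "l \<in> ?P" "x = a k" "y = a l" using xy(1,2) by blast
    then have "k < l"
      using ord [OF kl(2,1)] kl(3,4) xy(3) by (cases k l rule: linorder_cases) auto
    then show ?thesis using sep [OF kl(1,2)] kl by blast
  qed
  moreover have "\<exists>v\<in>{v\<in>{0..1}. ?F v < 0}. (\<forall>x\<in>a ` ?P. v < x) \<or> (\<forall>x\<in>a ` ?P. x < v)"
    if "a ` ?P \<noteq> {}"
  proof -
    have m: "0 < m" using that by auto
    have last: "m - 1 < m" "Suc (m - 1) mod m = 0" using m by auto
    have mem: "t 0 \<in> {0..1}" "t (m - 1) \<in> {0..1}" using t01 [OF m] t01 [OF last(1)] by auto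
    \<comment> \<open>The cyclic condition gives the last and first samples opposite signs. The
      negative one lies beyond all moved points.\<close>
    consider "?F (t 0) < 0" | "?F (t (m - 1)) < 0"
      using alt [OF last(1)] last(2) by (auto simp: mult_less_0_iff)
    then show ?thesis
    proof cases
      case 1
      have "t 0 < a k" if "k \<in> ?P" for k
      proof -
        have "k \<noteq> 0" using 1 that by (cases k) auto
        then show ?thesis using below [OF that m] tless [of 0 k] that by simp
      qed
      then show ?thesis using 1 mem(1) by blast
    next
      case 2
      have "a k < t (m - 1)" if "k \<in> ?P" for k
      proof -
        have "k \<noteq> m - 1" "k < m" using 2 that by auto
        then have "k < m - 1" by arith
        then show ?thesis using above [OF that last(1)] tless [of k "m - 1"] last(1) by blast
      qed
      then show ?thesis using 2 mem(2) by blast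
    qed
  qed
  ultimately show ?thesis
    using a acc by (intro exI [of _ "a ` ?P"] conjI) (auto simp: subset_iff)
qed

text \<open>Any attained count is allowed on each loop, \<open>0\<close> included, so the bound
  applies both to a single loop and to the sum of the maxima.\<close>

lemma sum_sign_changes_le:
  assumes seq: "\<And>i. i \<le> g \<Longrightarrow> \<exists>t. sign_change_sequence f (\<gamma> i) (\<mu> i) t"
  shows "(\<Sum>i\<le>g. \<mu> i) \<le> 2 * (card (nodal_domains f \<Omega>) + g - 1)"
proof -
  have "\<forall>i\<in>{..g}. \<exists>Q. finite Q \<and> Q \<subseteq> {0<..<1} \<and> \<mu> i = 2 * card Q \<and>
    (\<forall>a\<in>Q. \<exists>A\<in>nodal_domains f \<Omega>. accessible A (\<gamma> i a) \<and> (\<forall>z\<in>A. f z > 0)) \<and>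
    (\<forall>a\<in>Q. \<forall>b\<in>Q. a < b \<longrightarrow> (\<exists>v\<in>{v\<in>{0..1}. f (\<gamma> i v) < 0}. a < v \<and> v < b)) \<and>
    (Q \<noteq> {} \<longrightarrow> (\<exists>v\<in>{v\<in>{0..1}. f (\<gamma> i v) < 0}. (\<forall>a\<in>Q. v < a) \<or> (\<forall>a\<in>Q. a < v)))"
    (is "\<forall>i\<in>_. ?Q i")
  proof
    fix i assume "i \<in> {..g}"
    then have i: "i \<le> g" by simp
    obtain t where "sign_change_sequence f (\<gamma> i) (\<mu> i) t" using seq [OF i] ..
    from accessible_interlacing_set [OF i this] show "?Q i" .
  qed
  from bchoice [OF this] obtain Q where Q: "\<forall>i\<in>{..g}. finite (Q i) \<and> Q i \<subseteq> {0<..<1} \<and> \<mu> i = 2 * card (Q i) \<and>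
    (\<forall>a\<in>Q i. \<exists>A\<in>nodal_domains f \<Omega>. accessible A (\<gamma> i a) \<and> (\<forall>z\<in>A. f z > 0)) \<and>
    (\<forall>a\<in>Q i. \<forall>b\<in>Q i. a < b \<longrightarrow> (\<exists>v\<in>{v\<in>{0..1}. f (\<gamma> i v) < 0}. a < v \<and> v < b)) \<and>
    (Q i \<noteq> {} \<longrightarrow> (\<exists>v\<in>{v\<in>{0..1}. f (\<gamma> i v) < 0}. (\<forall>a\<in>Q i. v < a) \<or> (\<forall>a\<in>Q i. a < v)))" ..
  interpret interlaced_boundary_points \<Omega> g \<gamma> f Q
  proof unfold_locales
    fix i assume "i \<le> g"
    then have "i \<in> {..g}" by simp
    note Qi = bspec [OF Q this]
    show "finite (Q i)" "Q i \<subseteq> {0<..<1}" using Qi by blast+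
    show "\<exists>A\<in>nodal_domains f \<Omega>. accessible A (\<gamma> i a) \<and> (\<forall>z\<in>A. f z > 0)" if "a \<in> Q i" for a
      using Qi that by (elim conjE) (drule (1) bspec)
    show "\<exists>v\<in>{v\<in>{0..1}. f (\<gamma> i v) < 0}. a < v \<and> v < b" if "a \<in> Q i" "b \<in> Q i" "a < b" for a b
      using Qi that by simp
    show "\<exists>v\<in>{v\<in>{0..1}. f (\<gamma> i v) < 0}. (\<forall>a\<in>Q i. v < a) \<or> (\<forall>a\<in>Q i. a < v)" if "Q i \<noteq> {}"
      using Qi that by (elim conjE) (erule (1) mp)
  qed
  have sum: "(\<Sum>i\<le>g. \<mu> i) = 2 * card points"
    using Q by (simp add: card_points sum_distrib_left)
  show ?thesis
  \<comment> \<open>Without chosen points the sum is \<open>0\<close> and truncated subtraction does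
    no harm; otherwise \<open>card_points_less\<close> makes
    \<open>card (nodal_domains f \<Omega>) + g\<close> positive.\<close>
  proof (cases "points = {}")
    case False
    then show ?thesis using card_points_less sum by simp
  qed (use sum in simp)
qed

theorem sum_sign_changes_bound:
  "(\<Sum>i\<le>g. sign_changes f (\<gamma> i)) \<le> enat (2 * (card (nodal_domains f \<Omega>) + g - 1))"
proof -
  define X where "X i = {m. m \<ge> 2 \<and> (\<exists>t. sign_change_sequence f (\<gamma> i) m t)}" for i
  let ?B = "2 * (card (nodal_domains f \<Omega>) + g - 1)"
  have zero: "\<exists>t. sign_change_sequence f (\<gamma> i) 0 t" for i
    by (simp add: sign_change_sequence_def strict_mono_on_def)
  have fin: "finite (X i)" if i: "i \<le> g" for i
  proof (rule finite_subset)
    show "X i \<subseteq> {..?B}"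
    proof
      fix m assume "m \<in> X i"
      \<comment> \<open>Taking \<open>m\<close> on loop \<open>i\<close> and \<open>0\<close>
        elsewhere bounds the counts of each loop separately, so their suprema are attained
        maxima.\<close>
      then have "(\<Sum>j\<le>g. if j = i then m else 0) \<le> ?B"
        using zero by (intro sum_sign_changes_le) (auto simp: X_def)
      then show "m \<in> {..?B}" using i by simp
    qed
  qed simp
  have "(\<Sum>i\<le>g. Max (insert 0 (X i))) \<le> ?B"
  proof (rule sum_sign_changes_le)
    fix i assume "i \<le> g"
    then have "Max (insert 0 (X i)) \<in> insert 0 (X i)" using fin by (intro Max_in) auto
    then have "Max (insert 0 (X i)) = 0 \<or> Max (insert 0 (X i)) \<in> X i" by (rule insertE) auto
    then show "\<exists>t. sign_change_sequence f (\<gamma> i) (Max (insert 0 (X i))) t"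
    proof
      assume "Max (insert 0 (X i)) = 0"
      then show ?thesis using zero [of i] by simp
    next
      assume "Max (insert 0 (X i)) \<in> X i"
      moreover have "\<exists>t. sign_change_sequence f (\<gamma> i) m t" if "m \<in> X i" for m
        using that by (simp add: X_def)
      ultimately show ?thesis by blast
    qed
  qed
  moreover have "sign_changes f (\<gamma> i) = enat (Max (insert 0 (X i)))" if "i \<le> g" for i
    using Sup_enat_image_finite [OF fin [OF that]]
    unfolding sign_changes_def X_def sign_change_sequence_def by simp
  ultimately show ?thesis by (simp add: sum_enat)
qed

end

theorem theorem4p6:
  fixes \<Omega> :: "complex set" and g :: nat and \<gamma> :: "nat \<Rightarrow> real \<Rightarrow> complex"
    and f :: "complex \<Rightarrow> real"
  assumes "open \<Omega>" and "connected \<Omega>" and "bounded \<Omega>"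
    and "\<And>i. i \<le> g \<Longrightarrow> simple_path (\<gamma> i) \<and> pathfinish (\<gamma> i) = pathstart (\<gamma> i)"
    and "inj_on (\<lambda>i. path_image (\<gamma> i)) {..g}"
    and "components (frontier \<Omega>) = (\<lambda>i. path_image (\<gamma> i)) ` {..g}"
    and "continuous_on (closure \<Omega>) f"
    and "finite (nodal_domains f \<Omega>)"
  shows "(\<Sum>i\<le>g. sign_changes f (\<gamma> i)) \<le> enat (2 * (card (nodal_domains f \<Omega>) + g - 1))"
proof -
  interpret jordan_loop_domain \<Omega> g \<gamma> f
    by unfold_locales (fact assms)+
  show ?thesis by (rule sum_sign_changes_bound)
qed

end
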